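(* If a graph $G$ is in the switching class of a threshold graph (i.e. $G$ is obtained from some threshold graph by switching with respect to some vertex subset), then $G$ is a restricted 2-threshold graph.
   Context: Graphs are finite and simple. A threshold graph is a graph in which every induced subgraph has an isolated vertex or a universal vertex. For $G=(V,E)$ and $S\subseteq V$, switching $G$ with respect to $S$ means: for every pair $\{u,v\}$ with $u\in S$, $v\notin S$, add the edge if absent and remove it if present; other pairs are unchanged. Switching generates an equivalence relation whose classes are switching classes. Consider black/white colorings of the vertices (any map). A graph is a restricted 2-threshold graph if for some black/white coloring there is an ordering $v_1,\ldots,v_n$ of its vertices and, for each $j\ge 2$, an operator $\otimes_b$ or $\otimes_w$ such that $v_j$ is adjacent among $v_1,\ldots,v_{j-1}$ exactly to the black vertices (if its operator is $\otimes_b$) or exactly to the white vertices (if $\otimes_w$). *)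

theory Defs
  imports Main
begin

text \<open>
  A finite simple graph is given by its vertex set \<open>V\<close> and its edge set \<open>E\<close>, a set of
  two-element subsets of \<open>V\<close>.
\<close>

definition simple_graph :: "'a set \<Rightarrow> 'a set set \<Rightarrow> bool" where
  "simple_graph V E \<longleftrightarrow> finite V \<and> (\<forall>e\<in>E. e \<subseteq> V \<and> card e = 2)"

definition induced_edges :: "'a set set \<Rightarrow> 'a set \<Rightarrow> 'a set set" where
  "induced_edges E W = {e \<in> E. e \<subseteq> W}"

definition isolated_vertex :: "'a set \<Rightarrow> 'a set set \<Rightarrow> 'a \<Rightarrow> bool" where
  "isolated_vertex V E v \<longleftrightarrow> v \<in> V \<and> (\<forall>u\<in>V. {u, v} \<notin> E)"

definition universal_vertex :: "'a set \<Rightarrow> 'a set set \<Rightarrow> 'a \<Rightarrow> bool" where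
  "universal_vertex V E v \<longleftrightarrow> v \<in> V \<and> (\<forall>u\<in>V - {v}. {u, v} \<in> E)"

text \<open>The empty induced subgraph has no vertices at all and has to be excluded.\<close>

definition threshold_graph :: "'a set \<Rightarrow> 'a set set \<Rightarrow> bool" where
  "threshold_graph V E \<longleftrightarrow> simple_graph V E \<and>
     (\<forall>W\<subseteq>V. W \<noteq> {} \<longrightarrow>
        (\<exists>v. isolated_vertex W (induced_edges E W) v \<or>
             universal_vertex W (induced_edges E W) v))"

definition cut_pairs :: "'a set \<Rightarrow> 'a set \<Rightarrow> 'a set set" where
  "cut_pairs V S = {{u, v} | u v. u \<in> S \<and> v \<in> V - S}"

definition switch :: "'a set \<Rightarrow> 'a set \<Rightarrow> 'a set set \<Rightarrow> 'a set set" where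
  "switch V S E = (E - cut_pairs V S) \<union> (cut_pairs V S - E)"

definition switching :: "'a set \<Rightarrow> 'a set set \<Rightarrow> 'a set set \<Rightarrow> bool" where
  "switching V E E' \<longleftrightarrow> (\<exists>S\<subseteq>V. E' = switch V S E)"

definition switching_class :: "'a set \<Rightarrow> 'a set set \<Rightarrow> 'a set set set" where
  "switching_class V E = {E'. equivclp (switching V) E E'}"

text \<open>
  A single switching already reaches every member of the switching class, so the generated
  equivalence agrees with ``obtained by switching with respect to some vertex subset''.
\<close>

lemma cut_pairs_iff:
  assumes "S \<subseteq> V"
  shows "{u, v} \<in> cut_pairs V S \<longleftrightarrow> u \<in> V \<and> v \<in> V \<and> (u \<in> S) \<noteq> (v \<in> S)"
  using assms by (auto simp: cut_pairs_def doubleton_eq_iff)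

lemma cut_pairs_sym_diff:
  assumes "S \<subseteq> V" "T \<subseteq> V"
  shows "e \<in> cut_pairs V ((S - T) \<union> (T - S)) \<longleftrightarrow>
           (e \<in> cut_pairs V S) \<noteq> (e \<in> cut_pairs V T)"
proof (cases "\<exists>u v. e = {u, v}")
  case True
  then obtain u v where e: "e = {u, v}" by blast
  have "(S - T) \<union> (T - S) \<subseteq> V" using assms by blast
  from cut_pairs_iff[OF this] show ?thesis
    unfolding e by (auto simp: cut_pairs_iff[OF assms(1)] cut_pairs_iff[OF assms(2)])
next
  case False
  then show ?thesis by (auto simp: cut_pairs_def)
qed

lemma switch_switch:
  assumes "S \<subseteq> V" "T \<subseteq> V"
  shows "switch V T (switch V S E) = switch V ((S - T) \<union> (T - S)) E"
  using cut_pairs_sym_diff[OF assms] unfolding switch_def by blast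

lemma switching_class_iff: "E' \<in> switching_class V E \<longleftrightarrow> (\<exists>S\<subseteq>V. E' = switch V S E)"
proof -
  have refl: "switching V A A" for A
    unfolding switching_def by (rule exI[of _ "{}"]) (simp add: switch_def cut_pairs_def)
  have sym: "switching V B A" if "switching V A B" for A B
  proof -
    from that obtain S where S: "S \<subseteq> V" "B = switch V S A" by (auto simp: switching_def)
    have "A = switch V S B" unfolding S(2) by (auto simp: switch_def)
    with S(1) show ?thesis by (auto simp: switching_def)
  qed
  have trans: "switching V A C" if AB: "switching V A B" and BC: "switching V B C" for A B C
  proof -
    from AB obtain S where S: "S \<subseteq> V" "B = switch V S A" by (auto simp: switching_def)
    from BC obtain T where T: "T \<subseteq> V" "C = switch V T B" by (auto simp: switching_def)
    have "C = switch V ((S - T) \<union> (T - S)) A" using S T switch_switch by metis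
    moreover have "(S - T) \<union> (T - S) \<subseteq> V" using S(1) T(1) by blast
    ultimately show ?thesis unfolding switching_def by blast
  qed
  have "switching V A B" if "equivclp (switching V) A B" for A B
    using that by (induction rule: equivclp_induct) (blast intro: refl sym trans)+
  then show ?thesis
    unfolding switching_class_def switching_def[symmetric] by (auto intro: r_into_equivclp)
qed

datatype colour = Black | White

text \<open>
  The list \<open>vs\<close> is the vertex ordering, with positions counted from 0, so that the vertices
  carrying an operator are those at positions \<open>j \<ge> 1\<close>.  The operator at position \<open>j\<close> is
  represented by its colour \<open>op j\<close>: \<open>Black\<close> stands for $\otimes_b$ and \<open>White\<close> for $\otimes_w$.
\<close>

definition restricted_2_threshold_graph :: "'a set \<Rightarrow> 'a set set \<Rightarrow> bool" where
  "restricted_2_threshold_graph V E \<longleftrightarrow> simple_graph V E \<and>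
     (\<exists>(c :: 'a \<Rightarrow> colour) vs (op :: nat \<Rightarrow> colour).
        distinct vs \<and> set vs = V \<and>
        (\<forall>j. 1 \<le> j \<and> j < length vs \<longrightarrow>
           (\<forall>i<j. {vs ! i, vs ! j} \<in> E \<longleftrightarrow> c (vs ! i) = op j)))"

end

theory Submission imports Defs begin

text \<open>
  Removing isolated or universal vertices one by one orders the vertices of a threshold graph so
  that each vertex is adjacent to all or to none of its predecessors.  After switching with respect
  to \<open>S\<close>, each vertex is adjacent precisely to its predecessors inside \<open>S\<close>, or precisely to those
  outside \<open>S\<close>, so colouring \<open>S\<close> black and its complement white works with the same ordering.
\<close>

text \<open>Stated for every \<open>W\<close> inside \<open>V\<close>, so that the induction on
  \<open>card W\<close> can pass to \<open>W - {v}\<close>.\<close>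

lemma threshold_graph_elimination_ordering:
  assumes "threshold_graph V T" and "W \<subseteq> V"
  shows "\<exists>vs. distinct vs \<and> set vs = W \<and>
           (\<forall>j<length vs. \<exists>d. \<forall>i<j. {vs ! i, vs ! j} \<in> T \<longleftrightarrow> d)"
  using assms(2)
proof (induction "card W" arbitrary: W)
  case 0
  then have "W = {}"
    using assms(1) by (metis card_0_eq finite_subset simple_graph_def threshold_graph_def)
  then show ?case by (intro exI[of _ "[]"]) simp
next
  case (Suc n)
  from Suc.hyps(2) have "W \<noteq> {}" by auto
  then obtain v where v: "isolated_vertex W (induced_edges T W) v \<or>
      universal_vertex W (induced_edges T W) v"
    using assms(1) Suc.prems unfolding threshold_graph_def by blast
  then have vW: "v \<in> W" by (auto simp: isolated_vertex_def universal_vertex_def)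
  \<comment> \<open>\<open>d\<close> is \<open>False\<close> for isolated \<open>v\<close> and
    \<open>True\<close> for universal \<open>v\<close>.\<close>
  have "\<exists>d. \<forall>u\<in>W - {v}. {u, v} \<in> T \<longleftrightarrow> d"
    using v vW by (auto simp: isolated_vertex_def universal_vertex_def induced_edges_def)
  then obtain d where d: "\<forall>u\<in>W - {v}. {u, v} \<in> T \<longleftrightarrow> d" by blast
  have "n = card (W - {v})" using Suc.hyps(2) vW by simp
  from Suc.hyps(1)[OF this] Suc.prems obtain vs where
    vs: "distinct vs" "set vs = W - {v}"
      "\<forall>j<length vs. \<exists>d. \<forall>i<j. {vs ! i, vs ! j} \<in> T \<longleftrightarrow> d"
    by blast
  have "\<exists>d. \<forall>i<j. {(vs @ [v]) ! i, (vs @ [v]) ! j} \<in> T \<longleftrightarrow> d"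
    if j: "j < length (vs @ [v])" for j
  proof (cases "j < length vs")
    case True
    then show ?thesis using vs(3) by (simp add: nth_append)
  next
    case False
    then have "j = length vs" using j by simp
    moreover have "\<forall>i<length vs. {vs ! i, v} \<in> T \<longleftrightarrow> d"
      using d vs(2) nth_mem by blast
    ultimately show ?thesis by (auto simp: nth_append)
  qed
  \<comment> \<open>\<open>v\<close> goes last, so that its predecessors are all of
    \<open>W - {v}\<close>.\<close>
  then show ?case using vs vW by (intro exI[of _ "vs @ [v]"]) auto
qed

theorem theorem6:
  fixes V :: "'a set" and E :: "'a set set"
  assumes "simple_graph V E"
    and "\<exists>T. threshold_graph V T \<and> E \<in> switching_class V T"
  shows "restricted_2_threshold_graph V E"
proof -
  from assms(2) obtain T S where T: "threshold_graph V T" and S: "S \<subseteq> V" "E = switch V S T"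
    by (auto simp: switching_class_iff)
  \<comment> \<open>The flags of the single positions are collected into one function
    \<open>d\<close> by choice.\<close>
  from threshold_graph_elimination_ordering[OF T order_refl] obtain vs d where
    vs: "distinct vs" "set vs = V"
    and d: "\<And>i j. j < length vs \<Longrightarrow> i < j \<Longrightarrow> {vs ! i, vs ! j} \<in> T \<longleftrightarrow> d j"
    by metis
  define c where "c v = (if v \<in> S then Black else White)" for v
  \<comment> \<open>Membership of \<open>vs ! j\<close> in \<open>S\<close> decides which colour has
    its pairs flipped: white if inside, black if outside. The neighbours left are the black ones
    exactly when \<open>d j\<close> agrees with that membership.\<close>
  define op where "op j = (if d j = (vs ! j \<in> S) then Black else White)" for j
  have "{vs ! i, vs ! j} \<in> E \<longleftrightarrow> c (vs ! i) = op j" if "j < length vs" "i < j" for i j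
  proof -
    have "vs ! i \<in> V" "vs ! j \<in> V" using that vs(2) by auto
    then have "{vs ! i, vs ! j} \<in> E \<longleftrightarrow> d j \<noteq> ((vs ! i \<in> S) \<noteq> (vs ! j \<in> S))"
      using d[OF that] cut_pairs_iff[OF S(1), of "vs ! i" "vs ! j"] unfolding S(2) switch_def
      by blast
    then show ?thesis by (auto simp: c_def op_def)
  qed
  then show ?thesis using assms(1) vs unfolding restricted_2_threshold_graph_def by blast
qed

end
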